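(* Let $b,q$ be natural numbers and $a$ an integer with $\gcd(a,b)=1$. Then $S(a,b)=k/q$ for some integer $k$ with $\gcd(k,q)=1$ if and only if $b=\frac{q(a^2+1)}{t}$ for some natural number $t$ with $\gcd(t,q)=1$.
   Context: For $x\in\mathbb{R}$ let $((x))=x-\lfloor x\rfloor-1/2$ if $x\notin\mathbb{Z}$ and $((x))=0$ if $x\in\mathbb{Z}$. For $a\in\mathbb{Z}$, $b\in\mathbb{N}$ with $\gcd(a,b)=1$, the classical Dedekind sum is $s(a,b)=\sum_{j=1}^{b}((j/b))((aj/b))$, and the normalized Dedekind sum is $S(a,b)=12\,s(a,b)$. *)

theory Defs
  imports Complex_Main
begin

definition sawtooth :: "real \<Rightarrow> real" where
  "sawtooth x = (if x \<in> \<int> then 0 else x - of_int \<lfloor>x\<rfloor> - 1 / 2)"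

definition dedekind_sum :: "int \<Rightarrow> nat \<Rightarrow> real" where
  "dedekind_sum a b =
     (\<Sum>j = 1..b. sawtooth (real j / real b) * sawtooth (real_of_int a * real j / real b))"

definition normalized_dedekind_sum :: "int \<Rightarrow> nat \<Rightarrow> real" where
  "normalized_dedekind_sum a b = 12 * dedekind_sum a b"

end

theory Submission
  imports Defs
begin

text \<open>
  Write \<open>a j = b f\<^sub>j + r\<^sub>j\<close> with \<open>0 \<le> r\<^sub>j < b\<close>. Expanding the sawtooth products shows that
  \<open>N = b S(a, b)\<close> is an integer, congruent to \<open>2 a - 12 (\<Sum>j. j f\<^sub>j)\<close> modulo \<open>b\<close>. As \<open>r\<close> permutes
  the nonzero residues, \<open>\<Sum>j. r\<^sub>j\<^sup>2 = \<Sum>j. j\<^sup>2\<close>; expanding \<open>r\<^sub>j = a j - b f\<^sub>j\<close> in this identity gives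
  \<open>12 a (\<Sum>j. j f\<^sub>j) \<equiv> a\<^sup>2 - 1\<close>, and hence \<open>a N \<equiv> a\<^sup>2 + 1\<close> modulo \<open>b\<close>. Since \<open>a\<close> is a unit modulo
  \<open>b\<close>, the fractions \<open>N / b\<close> and \<open>(a\<^sup>2 + 1) / b\<close> have the same reduced denominator.
\<close>

text \<open>The unit \<open>a\<close> cancels modulo \<open>b\<close>, so the residue map is
  injective; it never takes the value 0, and equal cardinalities turn the inclusion of its image
  into equality.\<close>

lemma sum_residues_reindex:
  fixes a :: int and b :: nat and h :: "int \<Rightarrow> 'a::comm_monoid_add"
  assumes "coprime a (int b)"
  shows "(\<Sum>j=1..<b. h (a * int j mod int b)) = (\<Sum>j=1..<b. h (int j))"
proof -
  let ?r = "\<lambda>j. a * int j mod int b"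
  have inj: "inj_on ?r {1..<b}"
  proof (rule inj_onI)
    fix i j assume ij: "i \<in> {1..<b}" "j \<in> {1..<b}" "?r i = ?r j"
    then have "int b dvd a * (int i - int j)"
      by (simp add: mod_eq_dvd_iff right_diff_distrib)
    then have "int b dvd int i - int j"
      using assms by (simp add: coprime_commute coprime_dvd_mult_right_iff)
    then have "int i mod int b = int j mod int b"
      by (simp add: mod_eq_dvd_iff)
    then show "i = j" using ij by simp
  qed
  have sub: "?r ` {1..<b} \<subseteq> int ` {1..<b}"
  proof
    fix x assume "x \<in> ?r ` {1..<b}"
    then obtain j where j: "j \<in> {1..<b}" "x = ?r j" by auto
    have "\<not> int b dvd a * int j"
      using j assms by (auto simp: coprime_commute coprime_dvd_mult_right_iff dest: zdvd_imp_le)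
    then have "x \<noteq> 0" using j by (simp add: dvd_eq_mod_eq_0)
    moreover have "0 \<le> x" "x < int b" using j by auto
    ultimately have "nat x \<in> {1..<b}" "x = int (nat x)" by auto
    then show "x \<in> int ` {1..<b}" by blast
  qed
  have "card (?r ` {1..<b}) = card (int ` {1..<b})"
    using card_image[OF inj] by (simp add: card_image)
  then have "?r ` {1..<b} = int ` {1..<b}"
    using sub by (simp add: card_subset_eq)
  then have "sum h (?r ` {1..<b}) = sum h (int ` {1..<b})" by simp
  then show ?thesis using sum.reindex[OF inj, of h] by (simp add: sum.reindex)
qed

lemma sum_int_atLeastLessThan:
  "2 * (\<Sum>j=1..<b. int j) = int b * (int b - 1)"
  by (induction b) (auto simp: algebra_simps sum.atLeastLessThan_Suc)

lemma sum_int_squares_atLeastLessThan: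
  "6 * (\<Sum>j=1..<b. (int j)\<^sup>2) = int b * (int b - 1) * (2 * int b - 1)"
  by (induction b) (auto simp: algebra_simps power2_eq_square sum.atLeastLessThan_Suc)

lemma sawtooth_fraction:
  assumes "b > 0" "\<not> int b dvd m"
  shows "sawtooth (of_int m / real b) = of_int (m mod int b) / real b - 1 / 2"
proof -
  have "of_int m / real b \<notin> \<int>"
  proof
    assume "of_int m / real b \<in> \<int>"
    then obtain n where "of_int m / real b = of_int n" by (elim Ints_cases)
    then have "real_of_int m = of_int (n * int b)" using assms by (simp add: field_simps)
    then have "m = n * int b" by (simp only: of_int_eq_iff)
    then show False using assms by simp
  qed
  moreover have "\<lfloor>of_int m / real b\<rfloor> = m div int b"
    using floor_divide_of_int_eq[of m "int b"] by simp
  moreover have "real_of_int m = of_int (int b * (m div int b) + m mod int b)"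
    by simp
  then have "real_of_int m = real b * of_int (m div int b) + of_int (m mod int b)"
    by (simp only: of_int_add of_int_mult of_int_of_nat_eq)
  then have "of_int m / real b - of_int (m div int b) = of_int (m mod int b) / real b"
    using assms by (simp add: field_simps)
  ultimately show ?thesis by (simp add: sawtooth_def)
qed

text \<open>The factor \<open>(real b)\<^sup>2\<close> clears the denominators of both sawtooth
  values, which moves the computation into the integers.\<close>

lemma normalized_dedekind_sum_residues:
  assumes "b > 0" "coprime a (int b)"
  shows "(real b)\<^sup>2 * normalized_dedekind_sum a b =
    of_int (12 * (\<Sum>j=1..<b. int j * (a * int j mod int b)) - 3 * (int b)\<^sup>2 * (int b - 1))"
proof -
  let ?r = "\<lambda>j. a * int j mod int b"
  \<comment> \<open>The term \<open>j = b\<close> vanishes. For every smaller \<open>j\<close>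
    neither argument is an integer, so \<open>sawtooth_fraction\<close> applies to both
    factors.\<close>
  have last: "sawtooth 1 = 0"
    by (simp add: sawtooth_def)
  have "{1..b} = insert b {1..<b}" using assms by auto
  then have "dedekind_sum a b =
    (\<Sum>j=1..<b. sawtooth (real j / real b) * sawtooth (real_of_int a * real j / real b))"
    unfolding dedekind_sum_def using assms by (simp add: last)
  also have "\<dots> = (\<Sum>j=1..<b. (real j / b - 1/2) * (of_int (?r j) / b - 1/2))"
  proof (rule sum.cong)
    fix j assume j: "j \<in> {1..<b}"
    then have ndvd: "\<not> int b dvd int j" by (auto dest: zdvd_imp_le)
    then have "\<not> int b dvd a * int j"
      using assms by (simp add: coprime_commute coprime_dvd_mult_right_iff)
    then show "sawtooth (real j / real b) * sawtooth (real_of_int a * real j / real b)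
        = (real j / b - 1/2) * (of_int (?r j) / b - 1/2)"
      using sawtooth_fraction[OF assms(1) ndvd] sawtooth_fraction[OF assms(1), of "a * int j"] j
      by simp
  qed simp
  finally have "(real b)\<^sup>2 * normalized_dedekind_sum a b
      = (\<Sum>j=1..<b. (real b)\<^sup>2 * (12 * ((real j / b - 1/2) * (of_int (?r j) / b - 1/2))))"
    by (simp add: normalized_dedekind_sum_def sum_distrib_left)
  also have "\<dots> = (\<Sum>j=1..<b. of_int (12 * (int j * ?r j) - 6 * int b * int j
      - 6 * int b * ?r j + 3 * (int b)\<^sup>2))"
    using assms by (intro sum.cong refl) (simp add: field_simps power2_eq_square)
  also have "\<dots> = of_int (12 * (\<Sum>j=1..<b. int j * ?r j) - 6 * int b * (\<Sum>j=1..<b. int j)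
      - 6 * int b * (\<Sum>j=1..<b. ?r j) + (\<Sum>j=1..<b. 3 * (int b)\<^sup>2))"
    by (simp only: of_int_sum[symmetric] sum.distrib sum_subtractf sum_distrib_left)
  \<comment> \<open>Both linear sums now agree and together contribute -6 b^2 (b - 1), against 3 b^2
    (b - 1) from the constant terms.\<close>
  also have "(\<Sum>j=1..<b. ?r j) = (\<Sum>j=1..<b. int j)"
    by (rule sum_residues_reindex[OF assms(2)])
  also have "12 * (\<Sum>j=1..<b. int j * ?r j) - 6 * int b * (\<Sum>j=1..<b. int j)
      - 6 * int b * (\<Sum>j=1..<b. int j) + (\<Sum>j=1..<b. 3 * (int b)\<^sup>2)
    = 12 * (\<Sum>j=1..<b. int j * ?r j) - 6 * int b * (2 * (\<Sum>j=1..<b. int j))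
      + 3 * (int b)\<^sup>2 * (int b - 1)"
    using assms by (simp add: of_nat_diff)
  also have "\<dots> = 12 * (\<Sum>j=1..<b. int j * ?r j) - 3 * (int b)\<^sup>2 * (int b - 1)"
    unfolding sum_int_atLeastLessThan by (simp add: algebra_simps power2_eq_square)
  finally show ?thesis .
qed

lemma normalized_dedekind_sum_numerator:
  assumes "b > 0" "coprime a (int b)"
  obtains N where "normalized_dedekind_sum a b = of_int N / real b"
    and "int b dvd a * N - (a\<^sup>2 + 1)"
proof -
  let ?r = "\<lambda>j. a * int j mod int b"
  define f where "f j = a * int j div int b" for j
  define F where "F = (\<Sum>j=1..<b. int j * f j)"
  define G where "G = (\<Sum>j=1..<b. (f j)\<^sup>2)"
  define Q where "Q = (\<Sum>j=1..<b. (int j)\<^sup>2)"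
  define B where "B = int b"
  \<comment> \<open>This is (12 (a Q - B F) - 3 B^2 (B - 1)) / B, with the closed form of 6 Q
    inserted so that the division is exact.\<close>
  define N where "N = 2 * a * (B - 1) * (2 * B - 1) - 12 * F - 3 * B * (B - 1)"
  have B0: "B \<noteq> 0" using assms by (simp add: B_def)
  have Q: "6 * Q = B * (B - 1) * (2 * B - 1)"
    unfolding Q_def B_def by (rule sum_int_squares_atLeastLessThan)
  have r: "?r j = a * int j - B * f j" for j
    unfolding f_def B_def by (simp add: minus_mult_div_eq_mod)
  have jr: "(\<Sum>j=1..<b. int j * ?r j) = a * Q - B * F"
    unfolding r Q_def F_def sum_distrib_left sum_subtractf[symmetric]
    by (intro sum.cong refl) (simp add: algebra_simps power2_eq_square)
  \<comment> \<open>\<open>G\<close> enters with the factor B^2, so it still vanishes modulo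
    \<open>B\<close> after one factor \<open>B\<close> is cancelled. Multiplying by 6 makes
    \<open>B\<close> visible in \<open>Q\<close> too.\<close>
  have "Q = (\<Sum>j=1..<b. (?r j)\<^sup>2)"
    unfolding Q_def using sum_residues_reindex[OF assms(2), of "\<lambda>x. x\<^sup>2"] by simp
  also have "\<dots> = a\<^sup>2 * Q - 2 * a * B * F + B\<^sup>2 * G"
    unfolding r Q_def F_def G_def sum_distrib_left sum_subtractf[symmetric] sum.distrib[symmetric]
    by (intro sum.cong refl) (simp add: algebra_simps power2_eq_square)
  finally have "B * (12 * a * F) = (a\<^sup>2 - 1) * (6 * Q) + B * (6 * B * G)"
    by (simp add: algebra_simps power2_eq_square)
  also have "\<dots> = B * ((a\<^sup>2 - 1) * (B - 1) * (2 * B - 1) + 6 * B * G)"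
    unfolding Q by (simp add: algebra_simps)
  finally have aF: "12 * a * F = (a\<^sup>2 - 1) * (B - 1) * (2 * B - 1) + 6 * B * G"
    using B0 by simp
  have "12 * (\<Sum>j=1..<b. int j * ?r j) - 3 * (int b)\<^sup>2 * (int b - 1)
      = 2 * a * (6 * Q) - 12 * B * F - 3 * B\<^sup>2 * (B - 1)"
    unfolding jr by (simp add: B_def algebra_simps)
  also have "\<dots> = B * N"
    unfolding Q N_def by (simp add: algebra_simps power2_eq_square)
  finally have "(real b)\<^sup>2 * normalized_dedekind_sum a b = real b * of_int N"
    using normalized_dedekind_sum_residues[OF assms] by (simp add: B_def)
  then have "normalized_dedekind_sum a b = of_int N / real b"
    using assms by (simp add: field_simps power2_eq_square)
  moreover have "a * N = 2 * a\<^sup>2 * (B - 1) * (2 * B - 1) - 12 * a * F - 3 * a * B * (B - 1)"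
    unfolding N_def by (simp add: algebra_simps power2_eq_square)
  \<comment> \<open>By \<open>aF\<close>, the product (B - 1) (2 B - 1) = 1 + B (2 B - 3) gets the
    coefficient 2 a^2 - (a^2 - 1) = a^2 + 1.\<close>
  then have "a * N - (a\<^sup>2 + 1) = B * ((a\<^sup>2 + 1) * (2 * B - 3) - 6 * G - 3 * a * (B - 1))"
    unfolding aF by (simp add: algebra_simps power2_eq_square)
  then have "int b dvd a * N - (a\<^sup>2 + 1)" by (simp add: B_def)
  ultimately show thesis by (rule that)
qed

text \<open>Multiplying a numerator by a unit \<open>u\<close> modulo \<open>b\<close> preserves its
  gcd with \<open>b\<close>, so if \<open>N / b\<close> has reduced denominator \<open>q\<close>, so
  does \<open>M / b\<close>. A general \<open>u\<close> allows use in both directions, with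
  \<open>a\<close> and with its inverse.\<close>

lemma reduced_denominator_transfer:
  fixes u M N b q :: int
  assumes "b > 0" "q > 0" "coprime u b" "b dvd u * N - M" "coprime k q" "N * q = k * b"
  shows "\<exists>t. coprime t q \<and> M * q = t * b"
proof -
  have "q dvd b"
    using assms by (metis coprime_commute coprime_dvd_mult_right_iff dvd_triv_right)
  \<comment> \<open>Here \<open>d\<close> is the gcd of \<open>N\<close> and \<open>b\<close>; it
    also divides \<open>M\<close>.\<close>
  then obtain d where d: "b = q * d" by blast
  then have N: "N = k * d" using assms by simp
  have "d dvd u * N - M" using assms d by (meson dvd_trans dvd_triv_right)
  then have "d dvd M" using N by (metis dvd_diff_right_iff dvd_mult dvd_triv_right)
  then obtain t where t: "M = d * t" by blast
  \<comment> \<open>Cancelling \<open>d\<close> leaves \<open>t\<close> congruent to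
    \<open>u * k\<close> modulo \<open>q\<close>, and \<open>u\<close> is coprime to
    \<open>q\<close> because \<open>q\<close> divides \<open>b\<close>.\<close>
  have "q * d dvd (u * k - t) * d"
    using assms(4) unfolding d N t by (simp add: algebra_simps)
  then have "q dvd u * k - t" using assms d by auto
  then have "u * k mod q = t mod q" by (simp add: mod_eq_dvd_iff)
  moreover have "coprime (u * k) q" using assms d by simp
  ultimately have "coprime t q"
    using assms(2) by (metis coprime_mod_left_iff less_irrefl)
  then show ?thesis using t d by (intro exI[of _ t]) (simp add: algebra_simps)
qed

theorem theorem3:
  fixes a :: int and b q :: nat
  assumes "b > 0" and "q > 0" and "coprime a (int b)"
  shows "(\<exists>k::int. coprime k (int q) \<and> normalized_dedekind_sum a b = real_of_int k / real q)
     \<longleftrightarrow> (\<exists>t::nat. t > 0 \<and> coprime t q \<and>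
            real b = real q * ((real_of_int a)\<^sup>2 + 1) / real t)"
proof -
  obtain N where N: "normalized_dedekind_sum a b = of_int N / real b"
    and dvd: "int b dvd a * N - (a\<^sup>2 + 1)"
    using normalized_dedekind_sum_numerator[OF assms(1,3)] .
  have pos: "a\<^sup>2 + 1 > 0" by (simp add: add_nonneg_pos)
  have left: "normalized_dedekind_sum a b = real_of_int k / real q \<longleftrightarrow> N * int q = k * int b" for k
  proof -
    have "normalized_dedekind_sum a b = real_of_int k / real q
        \<longleftrightarrow> real_of_int (N * int q) = real_of_int (k * int b)"
      using assms by (simp add: N frac_eq_eq)
    then show ?thesis by (simp only: of_int_eq_iff)
  qed
  \<comment> \<open>Read as (a^2 + 1) / b = t / q, the condition on \<open>b\<close> has the same
    shape as the one on the Dedekind sum.\<close>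
  have right: "real b = real q * ((real_of_int a)\<^sup>2 + 1) / real t
      \<longleftrightarrow> (a\<^sup>2 + 1) * int q = int t * int b" if "t > 0" for t
  proof -
    have "real b = real q * ((real_of_int a)\<^sup>2 + 1) / real t
        \<longleftrightarrow> real_of_int ((a\<^sup>2 + 1) * int q) = real_of_int (int t * int b)"
      using that by (auto simp: field_simps)
    then show ?thesis by (simp only: of_int_eq_iff)
  qed
  \<comment> \<open>Bezout supplies an inverse \<open>c\<close> of \<open>a\<close> modulo
    \<open>b\<close>, the unit for the converse direction.\<close>
  obtain c d where c: "c * a + d * int b = 1"
    using bezout_int[of a "int b"] assms(3) by auto
  have "coprime c (int b)"
  proof (rule coprimeI)
    fix e assume "e dvd c" "e dvd int b"
    then have "e dvd c * a + d * int b" by simp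
    then show "e dvd 1" using c by simp
  qed
  show ?thesis
  proof
    assume "\<exists>k::int. coprime k (int q) \<and> normalized_dedekind_sum a b = real_of_int k / real q"
    then obtain k where "coprime k (int q)" "N * int q = k * int b" using left by blast
    then obtain t where t: "coprime t (int q)" "(a\<^sup>2 + 1) * int q = t * int b"
      using reduced_denominator_transfer[of "int b" "int q" a N "a\<^sup>2 + 1"] assms dvd by auto
    \<comment> \<open>The transfer gives only an integer \<open>t\<close>; positivity of a^2 + 1
      makes it a positive natural number.\<close>
    have "t * int b > 0" using t(2) pos assms by (metis mult_pos_pos of_nat_0_less_iff)
    then have "t > 0" using assms by (simp add: zero_less_mult_iff)
    then obtain n where "t = int n" "n > 0" by (metis zero_less_imp_eq_int)
    then show "\<exists>t::nat. t > 0 \<and> coprime t q \<and> real b = real q * ((real_of_int a)\<^sup>2 + 1) / real t"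
      using t right by auto
  next
    assume "\<exists>t::nat. t > 0 \<and> coprime t q \<and> real b = real q * ((real_of_int a)\<^sup>2 + 1) / real t"
    then obtain t :: nat where t: "coprime (int t) (int q)" "(a\<^sup>2 + 1) * int q = int t * int b"
      using right by auto
    \<comment> \<open>Multiplying the congruence by \<open>c\<close> reverses it: c (a^2 + 1) is
      congruent to \<open>N\<close> modulo \<open>b\<close>.\<close>
    have "c * (a * N - (a\<^sup>2 + 1)) = N * (c * a) - c * (a\<^sup>2 + 1)"
      by (simp add: algebra_simps)
    also have "c * a = 1 - d * int b" using c by simp
    finally have "c * (a\<^sup>2 + 1) - N = - c * (a * N - (a\<^sup>2 + 1)) - int b * (N * d)"
      by (simp add: algebra_simps)
    then have "int b dvd c * (a\<^sup>2 + 1) - N"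
      using dvd by (metis dvd_diff dvd_mult dvd_triv_left)
    then obtain k where "coprime k (int q)" "N * int q = k * int b"
      using reduced_denominator_transfer[of "int b" "int q" c "a\<^sup>2 + 1" N "int t"] assms t
        \<open>coprime c (int b)\<close> by auto
    then show "\<exists>k::int. coprime k (int q) \<and> normalized_dedekind_sum a b = real_of_int k / real q"
      using left by blast
  qed
qed

end
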